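(* Let $(M,\lambda_{(i)}(x,y))$ be a GAP-space equipped with a non-linear connection $N^\alpha_\mu$. The three curvature tensors $R^\alpha_{\nu\mu\sigma}$ ($h$-curvature), $S^\alpha_{\nu\mu\sigma}$ ($v$-curvature) and $P^\alpha_{\nu\mu\sigma}$ ($hv$-curvature) of the canonical $d$-connection $D=(N^\alpha_\mu,\Gamma^\alpha_{\mu\nu},C^\alpha_{\mu\nu})$ vanish identically.
   Context: $M$ is a $C^\infty$ manifold of dimension $n$, $\pi:TM\to M$ its tangent bundle with induced local coordinates $(x^\mu,y^\mu)$; $\partial_\mu=\partial/\partial x^\mu$, $\dot\partial_\mu=\partial/\partial y^\mu$. All objects are smooth in $(x,y)$. Summation convention on repeated Greek and repeated Latin indices. A non-linear connection is a system of functions $N^\alpha_\beta(x,y)$ on induced charts of $TM$ transforming by $N^{\alpha'}_{\beta'}=p^{\alpha'}_{\alpha}p^{\beta}_{\beta'}N^\alpha_\beta+p^{\alpha'}_{\epsilon}p^{\epsilon}_{\beta'\sigma'}y^{\sigma'}$, where $p^{\alpha'}_{\alpha}=\partial x^{\alpha'}/\partial x^{\alpha}$, $p^{\epsilon}_{\beta'\sigma'}=\partial^2x^\epsilon/\partial x^{\beta'}\partial x^{\sigma'}$; set $\delta_\mu=\partial_\mu-N^\alpha_\mu\dot\partial_\alpha$. A GAP-space is a manifold $M$ together with $n$ global linearly independent sections $\lambda_{(i)}=(\lambda_{(i)}^\alpha(x,y))$ of the pullback bundle $\pi^{-1}(TM)$; $(\lambda_{(i)\alpha})$ is the inverse matrix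 ($\lambda_{(i)}^\alpha\lambda_{(i)\beta}=\delta^\alpha_\beta$, $\lambda_{(i)}^\alpha\lambda_{(j)\alpha}=\delta_{ij}$). The canonical $d$-connection is $D=(N^\alpha_\mu,\Gamma^\alpha_{\mu\nu},C^\alpha_{\mu\nu})$ with $\Gamma^\alpha_{\mu\nu}=\lambda_{(i)}^\alpha\delta_\nu\lambda_{(i)\mu}$, $C^\alpha_{\mu\nu}=\lambda_{(i)}^\alpha\dot\partial_\nu\lambda_{(i)\mu}$; equivalently, the unique $d$-connection with non-linear part $N$ for which the $h$- and $v$-covariant derivatives of all $\lambda_{(i)}$ vanish. The $h$-covariant derivative is $A^\alpha_{\mu|\nu}=\delta_\nu A^\alpha_\mu+A^\epsilon_\mu\Gamma^\alpha_{\epsilon\nu}-A^\alpha_\epsilon\Gamma^\epsilon_{\mu\nu}$ (similarly for other tensor types), and the $v$-covariant derivative is obtained by replacing $\delta_\nu$ by $\dot\partial_\nu$ and $\Gamma$ by $C$. Curvature tensors: with $R^\alpha_{\sigma\mu}:=\delta_\mu N^\alpha_\sigma-\delta_\sigma N^\alpha_\mu$, $L^\alpha_{\nu\mu\sigma}:=C^\alpha_{\nu\epsilon}R^\epsilon_{\mu\sigma}$ and $P^\nu_{\sigma\mu}:=\dot\partial_\mu N^\nu_\sigma-\Gamma^\nu_{\mu\sigma}$, $$R^\alpha_{\nu\mu\sigma}:=\delta_\sigma\Gamma^\alpha_{\nu\mu}-\delta_\mu\Gamma^\alpha_{\nu\sigma}+\Gamma^\epsilon_{\nu\mu}\Gamma^\alpha_{\epsilon\sigma}-\Gamma^\epsilon_{\nu\sigma}\Gamma^\alpha_{\epsilon\mu}+L^\alpha_{\nu\mu\sigma},$$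 $$S^\alpha_{\nu\mu\sigma}:=\dot\partial_\sigma C^\alpha_{\nu\mu}-\dot\partial_\mu C^\alpha_{\nu\sigma}+C^\epsilon_{\nu\mu}C^\alpha_{\epsilon\sigma}-C^\epsilon_{\nu\sigma}C^\alpha_{\epsilon\mu},$$ $$P^\alpha_{\nu\mu\sigma}:=C^\alpha_{\nu\mu|\sigma}-\dot\partial_\mu\Gamma^\alpha_{\nu\sigma}-P^\epsilon_{\sigma\mu}C^\alpha_{\nu\epsilon}.$$ *)

theory Defs
  imports "HOL-Analysis.Analysis"
begin

section \<open>Smooth functions and smooth manifolds\<close>

text \<open>\<open>Ck_on k S f\<close> and \<open>smooth_on S f\<close> are used for open \<open>S\<close> only.\<close>

primrec Ck_on :: "nat \<Rightarrow> 'a::real_normed_vector set \<Rightarrow> ('a \<Rightarrow> 'b::real_normed_vector) \<Rightarrow> bool" where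
  "Ck_on 0 S f \<longleftrightarrow> continuous_on S f"
| "Ck_on (Suc k) S f \<longleftrightarrow>
     (\<forall>x\<in>S. f differentiable (at x)) \<and> (\<forall>v. Ck_on k S (\<lambda>x. frechet_derivative f (at x) v))"

definition smooth_on :: "'a::real_normed_vector set \<Rightarrow> ('a \<Rightarrow> 'b::real_normed_vector) \<Rightarrow> bool" where
  "smooth_on S f \<longleftrightarrow> (\<forall>k. Ck_on k S f)"

text \<open>A chart \<open>(U, \<phi>)\<close> consists of its domain and its coordinate map; the values of \<open>\<phi>\<close>
  outside \<open>U\<close> are irrelevant. The dimension of the manifold is \<open>CARD('n)\<close>.\<close>

type_synonym ('m, 'n) chart = "'m set \<times> ('m \<Rightarrow> real^'n)"

definition is_chart :: "'m topology \<Rightarrow> ('m, 'n::finite) chart \<Rightarrow> bool" where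
  "is_chart X c \<longleftrightarrow>
     openin X (fst c) \<and> open (snd c ` fst c) \<and>
     homeomorphic_map (subtopology X (fst c)) (top_of_set (snd c ` fst c)) (snd c)"

definition chart_inv :: "('m, 'n::finite) chart \<Rightarrow> real^'n \<Rightarrow> 'm" where
  "chart_inv c = inv_into (fst c) (snd c)"

definition overlap :: "('m, 'n::finite) chart \<Rightarrow> ('m, 'n) chart \<Rightarrow> (real^'n) set" where
  "overlap c d = snd c ` (fst c \<inter> fst d)"

definition coord_change :: "('m, 'n::finite) chart \<Rightarrow> ('m, 'n) chart \<Rightarrow> real^'n \<Rightarrow> real^'n" where
  "coord_change c d x = snd d (chart_inv c x)"

definition smooth_manifold :: "'m topology \<Rightarrow> ('m, 'n::finite) chart set \<Rightarrow> bool" where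
  "smooth_manifold X A \<longleftrightarrow>
     Hausdorff_space X \<and> second_countable X \<and>
     (\<Union>c\<in>A. fst c) = topspace X \<and>
     (\<forall>c\<in>A. is_chart X c) \<and>
     (\<forall>c\<in>A. \<forall>d\<in>A. smooth_on (overlap c d) (coord_change c d))"

definition pd :: "'n \<Rightarrow> (real^'n::finite \<Rightarrow> real) \<Rightarrow> real^'n \<Rightarrow> real" where
  "pd \<mu> f x = frechet_derivative f (at x) (axis \<mu> 1)"

text \<open>With \<open>x\<close> the coordinates of \<open>c\<close> and \<open>x'\<close> those of \<open>d\<close>, \<open>jac c d \<alpha>' \<alpha> x\<close> is
  \<open>\<partial>x'\<^sup>\<alpha>\<^sup>' / \<partial>x\<^sup>\<alpha>\<close> and \<open>hess c d \<alpha>' \<beta> \<sigma> x\<close> is \<open>\<partial>\<^sup>2x'\<^sup>\<alpha>\<^sup>' / \<partial>x\<^sup>\<beta>\<partial>x\<^sup>\<sigma>\<close>,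
  both at the point with \<open>c\<close>-coordinates \<open>x\<close>.\<close>

definition jac :: "('m, 'n::finite) chart \<Rightarrow> ('m, 'n) chart \<Rightarrow> 'n \<Rightarrow> 'n \<Rightarrow> real^'n \<Rightarrow> real" where
  "jac c d \<alpha>' \<alpha> = pd \<alpha> (\<lambda>x. coord_change c d x $ \<alpha>')"

definition hess :: "('m, 'n::finite) chart \<Rightarrow> ('m, 'n) chart \<Rightarrow> 'n \<Rightarrow> 'n \<Rightarrow> 'n \<Rightarrow> real^'n \<Rightarrow> real" where
  "hess c d \<alpha>' \<beta> \<sigma> = pd \<beta> (pd \<sigma> (\<lambda>x. coord_change c d x $ \<alpha>'))"


section \<open>The tangent bundle\<close>

text \<open>A tangent vector at \<open>p\<close> is the family of its component vectors in all charts around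
  \<open>p\<close>, subject to the contravariant transformation law. The components in other charts are set
  to \<open>0\<close>, so that a tangent vector is determined by its components.\<close>

type_synonym ('m, 'n) tvec = "('m, 'n) chart \<Rightarrow> real^'n"

definition tangent_space :: "('m, 'n::finite) chart set \<Rightarrow> 'm \<Rightarrow> ('m, 'n) tvec set" where
  "tangent_space A p =
     {v. (\<forall>c\<in>A. \<forall>d\<in>A. p \<in> fst c \<inter> fst d \<longrightarrow>
            (\<forall>\<alpha>'. v d $ \<alpha>' = (\<Sum>\<alpha>\<in>UNIV. jac c d \<alpha>' \<alpha> (snd c p) * v c $ \<alpha>))) \<and>
         (\<forall>c. c \<notin> A \<or> p \<notin> fst c \<longrightarrow> v c = 0)}"

definition tangent_bundle :: "'m topology \<Rightarrow> ('m, 'n::finite) chart set \<Rightarrow> ('m \<times> ('m, 'n) tvec) set" where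
  "tangent_bundle X A = (SIGMA p:topspace X. tangent_space A p)"

definition induced_dom :: "('m, 'n::finite) chart set \<Rightarrow> ('m, 'n) chart \<Rightarrow> ('m \<times> ('m, 'n) tvec) set" where
  "induced_dom A c = (SIGMA p:fst c. tangent_space A p)"

definition induced_chart :: "('m, 'n::finite) chart \<Rightarrow> 'm \<times> ('m, 'n) tvec \<Rightarrow> (real^'n) \<times> (real^'n)" where
  "induced_chart c u = (snd c (fst u), snd u c)"

definition induced_range :: "('m, 'n::finite) chart \<Rightarrow> ((real^'n) \<times> (real^'n)) set" where
  "induced_range c = (snd c ` fst c) \<times> UNIV"

definition induced_inv ::
    "('m, 'n::finite) chart set \<Rightarrow> ('m, 'n) chart \<Rightarrow> (real^'n) \<times> (real^'n) \<Rightarrow> 'm \<times> ('m, 'n) tvec" where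
  "induced_inv A c = inv_into (induced_dom A c) (induced_chart c)"

text \<open>\<open>px \<mu>\<close> and \<open>py \<mu>\<close> are the partial derivatives with respect to \<open>x\<^sup>\<mu>\<close> and \<open>y\<^sup>\<mu>\<close>.\<close>

definition px :: "'n \<Rightarrow> ((real^'n::finite) \<times> (real^'n) \<Rightarrow> real) \<Rightarrow> (real^'n) \<times> (real^'n) \<Rightarrow> real" where
  "px \<mu> f z = frechet_derivative f (at z) (axis \<mu> 1, 0)"

definition py :: "'n \<Rightarrow> ((real^'n::finite) \<times> (real^'n) \<Rightarrow> real) \<Rightarrow> (real^'n) \<times> (real^'n) \<Rightarrow> real" where
  "py \<mu> f z = frechet_derivative f (at z) (0, axis \<mu> 1)"

text \<open>Coordinate expressions of objects on the tangent bundle: functions of the induced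
  coordinates \<open>(x, y)\<close>, with upper indices before lower ones, e.g. \<open>N \<alpha> \<beta>\<close> for \<open>N\<^sup>\<alpha>\<^sub>\<beta>\<close>
  and \<open>G \<alpha> \<mu> \<nu>\<close> for \<open>\<Gamma>\<^sup>\<alpha>\<^sub>\<mu>\<^sub>\<nu>\<close>.\<close>

type_synonym 'n coord_fun = "(real^'n) \<times> (real^'n) \<Rightarrow> real"
type_synonym 'n coef2 = "'n \<Rightarrow> 'n \<Rightarrow> 'n coord_fun"
type_synonym 'n coef3 = "'n \<Rightarrow> 'n \<Rightarrow> 'n \<Rightarrow> 'n coord_fun"
type_synonym 'n coef4 = "'n \<Rightarrow> 'n \<Rightarrow> 'n \<Rightarrow> 'n \<Rightarrow> 'n coord_fun"


section \<open>Non-linear connections and GAP-spaces\<close>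

definition induced_change ::
    "('m, 'n::finite) chart \<Rightarrow> ('m, 'n) chart \<Rightarrow> (real^'n) \<times> (real^'n) \<Rightarrow> (real^'n) \<times> (real^'n)" where
  "induced_change c d z =
     (coord_change c d (fst z), \<chi> \<alpha>'. \<Sum>\<alpha>\<in>UNIV. jac c d \<alpha>' \<alpha> (fst z) * snd z $ \<alpha>)"

definition nonlinear_connection ::
    "('m, 'n::finite) chart set \<Rightarrow> (('m, 'n) chart \<Rightarrow> 'n coef2) \<Rightarrow> bool" where
  "nonlinear_connection A N \<longleftrightarrow>
     (\<forall>c\<in>A. \<forall>\<alpha> \<beta>. smooth_on (induced_range c) (N c \<alpha> \<beta>)) \<and>
     (\<forall>c\<in>A. \<forall>d\<in>A. \<forall>z\<in>overlap c d \<times> UNIV. \<forall>\<alpha>' \<beta>'.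
        let z' = induced_change c d z; x = fst z; x' = fst z'; y' = snd z' in
        N d \<alpha>' \<beta>' z' =
          (\<Sum>\<alpha>\<in>UNIV. \<Sum>\<beta>\<in>UNIV. jac c d \<alpha>' \<alpha> x * jac d c \<beta> \<beta>' x' * N c \<alpha> \<beta> z) +
          (\<Sum>\<epsilon>\<in>UNIV. \<Sum>\<sigma>'\<in>UNIV. jac c d \<alpha>' \<epsilon> x * hess d c \<epsilon> \<beta>' \<sigma>' x' * y' $ \<sigma>'))"

text \<open>A section of the pullback bundle \<open>\<pi>\<^sup>-\<^sup>1(TM)\<close> assigns to \<open>u \<in> TM\<close> a tangent vector
  at \<open>\<pi> u\<close>.\<close>

type_synonym ('m, 'n) psection = "'m \<times> ('m, 'n) tvec \<Rightarrow> ('m, 'n) tvec"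

definition section_comp ::
    "('m, 'n::finite) chart set \<Rightarrow> ('m, 'n) psection \<Rightarrow> ('m, 'n) chart \<Rightarrow> 'n \<Rightarrow> 'n coord_fun" where
  "section_comp A s c \<alpha> z = s (induced_inv A c z) c $ \<alpha>"

definition pullback_section ::
    "'m topology \<Rightarrow> ('m, 'n::finite) chart set \<Rightarrow> ('m, 'n) psection \<Rightarrow> bool" where
  "pullback_section X A s \<longleftrightarrow>
     (\<forall>u\<in>tangent_bundle X A. s u \<in> tangent_space A (fst u)) \<and>
     (\<forall>c\<in>A. \<forall>\<alpha>. smooth_on (induced_range c) (section_comp A s c \<alpha>))"

text \<open>The Latin indices labelling the \<open>n\<close> sections run over the same index type \<open>'n\<close> as the
  coordinate indices. Linear independence is pointwise on \<open>TM\<close>; the vector space operations of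
  a tangent space are those of the components.\<close>

definition gap_space ::
    "'m topology \<Rightarrow> ('m, 'n::finite) chart set \<Rightarrow> ('n \<Rightarrow> ('m, 'n) psection) \<Rightarrow> bool" where
  "gap_space X A lam \<longleftrightarrow>
     smooth_manifold X A \<and>
     (\<forall>i. pullback_section X A (lam i)) \<and>
     (\<forall>u\<in>tangent_bundle X A. \<forall>a.
        (\<forall>c. (\<Sum>i\<in>UNIV. a i *\<^sub>R lam i u c) = 0) \<longrightarrow> (\<forall>i. a i = 0))"

text \<open>The covariant components \<open>\<lambda>\<^sub>(\<^sub>i\<^sub>)\<^sub>\<alpha>\<close>.\<close>

definition colam ::
    "('m, 'n::finite) chart set \<Rightarrow> ('n \<Rightarrow> ('m, 'n) psection) \<Rightarrow> ('m, 'n) chart \<Rightarrow> 'n \<Rightarrow> 'n \<Rightarrow> 'n coord_fun" where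
  "colam A lam c i \<alpha> z = matrix_inv (\<chi> \<beta> j. section_comp A (lam j) c \<beta> z) $ i $ \<alpha>"


section \<open>d-connections and their curvature tensors\<close>

text \<open>Coordinate expression \<open>(N, \<Gamma>, C)\<close> of a d-connection in one chart.\<close>

record 'n d_connection =
  nl :: "'n coef2"
  hor :: "'n coef3"
  ver :: "'n coef3"

definition delta :: "'n::finite coef2 \<Rightarrow> 'n \<Rightarrow> 'n coord_fun \<Rightarrow> 'n coord_fun" where
  "delta N \<mu> f z = px \<mu> f z - (\<Sum>\<alpha>\<in>UNIV. N \<alpha> \<mu> z * py \<alpha> f z)"

definition canonical_d_connection ::
    "('m, 'n::finite) chart set \<Rightarrow> ('n \<Rightarrow> ('m, 'n) psection) \<Rightarrow> (('m, 'n) chart \<Rightarrow> 'n coef2) \<Rightarrow>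
     ('m, 'n) chart \<Rightarrow> 'n d_connection" where
  "canonical_d_connection A lam N c =
     \<lparr> nl = N c,
       hor = (\<lambda>\<alpha> \<mu> \<nu> z. \<Sum>i\<in>UNIV. section_comp A (lam i) c \<alpha> z * delta (N c) \<nu> (colam A lam c i \<mu>) z),
       ver = (\<lambda>\<alpha> \<mu> \<nu> z. \<Sum>i\<in>UNIV. section_comp A (lam i) c \<alpha> z * py \<nu> (colam A lam c i \<mu>) z) \<rparr>"

text \<open>The h-covariant derivative \<open>T\<^sup>\<alpha>\<^sub>\<nu>\<^sub>\<mu>\<^sub>|\<^sub>\<sigma>\<close> of a tensor with one upper and two lower indices.\<close>

definition h_cov12 :: "'n::finite d_connection \<Rightarrow> 'n coef3 \<Rightarrow> 'n coef4" where
  "h_cov12 D T \<alpha> \<nu> \<mu> \<sigma> z =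
     delta (nl D) \<sigma> (T \<alpha> \<nu> \<mu>) z
     + (\<Sum>\<epsilon>\<in>UNIV. T \<epsilon> \<nu> \<mu> z * hor D \<alpha> \<epsilon> \<sigma> z)
     - (\<Sum>\<epsilon>\<in>UNIV. T \<alpha> \<epsilon> \<mu> z * hor D \<epsilon> \<nu> \<sigma> z)
     - (\<Sum>\<epsilon>\<in>UNIV. T \<alpha> \<nu> \<epsilon> z * hor D \<epsilon> \<mu> \<sigma> z)"

definition nl_curv :: "'n::finite d_connection \<Rightarrow> 'n coef3" where
  "nl_curv D \<alpha> \<sigma> \<mu> z = delta (nl D) \<mu> (nl D \<alpha> \<sigma>) z - delta (nl D) \<sigma> (nl D \<alpha> \<mu>) z"

definition L_tensor :: "'n::finite d_connection \<Rightarrow> 'n coef4" where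
  "L_tensor D \<alpha> \<nu> \<mu> \<sigma> z = (\<Sum>\<epsilon>\<in>UNIV. ver D \<alpha> \<nu> \<epsilon> z * nl_curv D \<epsilon> \<mu> \<sigma> z)"

definition P_torsion :: "'n::finite d_connection \<Rightarrow> 'n coef3" where
  "P_torsion D \<nu> \<sigma> \<mu> z = py \<mu> (nl D \<nu> \<sigma>) z - hor D \<nu> \<mu> \<sigma> z"

definition h_curvature :: "'n::finite d_connection \<Rightarrow> 'n coef4" where
  "h_curvature D \<alpha> \<nu> \<mu> \<sigma> z =
     delta (nl D) \<sigma> (hor D \<alpha> \<nu> \<mu>) z - delta (nl D) \<mu> (hor D \<alpha> \<nu> \<sigma>) z
     + (\<Sum>\<epsilon>\<in>UNIV. hor D \<epsilon> \<nu> \<mu> z * hor D \<alpha> \<epsilon> \<sigma> z)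
     - (\<Sum>\<epsilon>\<in>UNIV. hor D \<epsilon> \<nu> \<sigma> z * hor D \<alpha> \<epsilon> \<mu> z)
     + L_tensor D \<alpha> \<nu> \<mu> \<sigma> z"

definition v_curvature :: "'n::finite d_connection \<Rightarrow> 'n coef4" where
  "v_curvature D \<alpha> \<nu> \<mu> \<sigma> z =
     py \<sigma> (ver D \<alpha> \<nu> \<mu>) z - py \<mu> (ver D \<alpha> \<nu> \<sigma>) z
     + (\<Sum>\<epsilon>\<in>UNIV. ver D \<epsilon> \<nu> \<mu> z * ver D \<alpha> \<epsilon> \<sigma> z)
     - (\<Sum>\<epsilon>\<in>UNIV. ver D \<epsilon> \<nu> \<sigma> z * ver D \<alpha> \<epsilon> \<mu> z)"

definition hv_curvature :: "'n::finite d_connection \<Rightarrow> 'n coef4" where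
  "hv_curvature D \<alpha> \<nu> \<mu> \<sigma> z =
     h_cov12 D (ver D) \<alpha> \<nu> \<mu> \<sigma> z - py \<mu> (hor D \<alpha> \<nu> \<sigma>) z
     - (\<Sum>\<epsilon>\<in>UNIV. P_torsion D \<epsilon> \<sigma> \<mu> z * ver D \<alpha> \<nu> \<epsilon> z)"

end

theory Submission
  imports Defs
begin

text \<open>The canonical d-connection makes the frame \<open>\<lambda>\<^sub>(\<^sub>i\<^sub>)\<close> parallel. Along a vector field \<open>V\<close> on a
  chart of the tangent bundle its coefficients are \<open>\<omega>\<^sub>V = \<lambda>\<^sub>(\<^sub>i\<^sub>) \<otimes> V(\<lambda>\<^sub>(\<^sub>i\<^sub>))\<close>, so that \<open>\<Gamma>\<close> and \<open>C\<close> are the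
  values of \<open>\<omega>\<close> on \<open>\<delta>\<^sub>\<mu>\<close> and \<open>\<partial>/\<partial>y\<^sup>\<mu>\<close>. The form \<open>\<omega>\<close> is flat, and the three curvature tensors are the
  Maurer--Cartan expressions of \<open>\<omega>\<close> on the pairs \<open>(\<delta>, \<delta>)\<close>, \<open>(\<partial>/\<partial>y, \<partial>/\<partial>y)\<close> and \<open>(\<delta>, \<partial>/\<partial>y)\<close>: the terms
  with \<open>L\<close> and with \<open>\<partial>N/\<partial>y\<close> in the torsion \<open>P\<close> are the contributions of the brackets, and the
  remaining \<open>\<Gamma>C\<close> terms of \<open>P\<close> and of the h-covariant derivative cancel.\<close>

section \<open>Symmetry of second derivatives\<close>

text \<open>Two uses of the mean value theorem, first along \<open>v\<close> for the increment of
  \<open>f\<close> by \<open>t *\<^sub>R w\<close>, then along \<open>w\<close> for the derivative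
  of \<open>f\<close> in direction \<open>v\<close>, turn the quotient into the value of the mixed
  derivative at a point near \<open>z\<close>. Continuity of that derivative, the last clause of
  \<open>Ck_on 2\<close>, gives the limit.\<close>

lemma second_difference_quotient_tendsto:
  fixes f :: "'a::real_normed_vector \<Rightarrow> real"
  assumes S: "open S" "z \<in> S" and f: "Ck_on 2 S f"
  shows "((\<lambda>t. (f (z + t *\<^sub>R v + t *\<^sub>R w) - f (z + t *\<^sub>R v) - f (z + t *\<^sub>R w) + f z) / t\<^sup>2)
          \<longlongrightarrow> frechet_derivative (\<lambda>x. frechet_derivative f (at x) v) (at z) w) (at_right 0)"
proof -
  define g where "g x = frechet_derivative f (at x) v" for x
  define h where "h x = frechet_derivative g (at x) w" for x
  have df: "(f has_derivative frechet_derivative f (at x)) (at x)"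
    and dg: "(g has_derivative frechet_derivative g (at x)) (at x)" if "x \<in> S" for x
    using f that unfolding frechet_derivative_works[symmetric] g_def by (auto simp: numeral_2_eq_2)
  have "continuous_on S h"
    using f unfolding h_def g_def by (auto simp: numeral_2_eq_2)
  then have h: "isCont h z"
    using S continuous_on_eq_continuous_at by blast
  obtain r where r: "r > 0" "ball z r \<subseteq> S"
    using S open_contains_ball by blast
  show ?thesis
  proof (rule tendstoI)
    fix e :: real assume "e > 0"
    then obtain d where d: "d > 0" "\<And>x. dist x z < d \<Longrightarrow> dist (h x) (h z) < e"
      using h unfolding continuous_at_eps_delta by blast
    \<comment> \<open>The summand 1 keeps \<open>k\<close> positive for \<open>v = w = 0\<close> and
      makes the estimate \<open>t * norm v + t * norm w < t * k\<close> strict.\<close>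
    define k where "k = norm v + norm w + 1"
    have k: "k > 0"
      unfolding k_def by (smt (verit) norm_ge_zero)
    define \<delta> where "\<delta> = min r d / k"
    have \<delta>: "\<delta> > 0"
      using r d k by (simp add: \<delta>_def)
    have near: "dist (z + a *\<^sub>R v + b *\<^sub>R w) z < min r d"
      if "0 \<le> a" "a \<le> t" "0 \<le> b" "b \<le> t" "0 < t" "t < \<delta>" for a b t
    proof -
      have "dist (z + a *\<^sub>R v + b *\<^sub>R w) z \<le> norm (a *\<^sub>R v) + norm (b *\<^sub>R w)"
        by (simp add: dist_norm add.assoc norm_triangle_ineq del: norm_scaleR)
      also have "\<dots> \<le> t * norm v + t * norm w"
        using that by (auto intro!: add_mono mult_right_mono)
      also have "\<dots> < t * k"
        using that by (simp add: k_def algebra_simps)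
      also have "\<dots> < min r d"
        using that k unfolding \<delta>_def by (simp add: pos_less_divide_eq)
      finally show ?thesis .
    qed
    have "dist ((f (z + t *\<^sub>R v + t *\<^sub>R w) - f (z + t *\<^sub>R v) - f (z + t *\<^sub>R w) + f z) / t\<^sup>2) (h z) < e"
      if t: "0 < t" "t < \<delta>" for t
    proof -
      have inS: "z + a *\<^sub>R v + b *\<^sub>R w \<in> S" if "0 \<le> a" "a \<le> t" "0 \<le> b" "b \<le> t" for a b
        using near[OF that t] r by (auto simp: dist_commute)
      have fv: "((\<lambda>s. f (z + s *\<^sub>R v + b *\<^sub>R w)) has_derivative
                  (\<lambda>s'. s' * g (z + s *\<^sub>R v + b *\<^sub>R w))) (at s)"
        if "0 \<le> s" "s \<le> t" "0 \<le> b" "b \<le> t" for s b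
      proof -
        have "((\<lambda>s. f (z + s *\<^sub>R v + b *\<^sub>R w)) has_derivative
                (\<lambda>s'. frechet_derivative f (at (z + s *\<^sub>R v + b *\<^sub>R w)) (s' *\<^sub>R v))) (at s)"
          by (rule has_derivative_compose[where f = "\<lambda>s. z + s *\<^sub>R v + b *\<^sub>R w", OF _ df[OF inS[OF that]]]) (auto intro!: derivative_eq_intros)
        then show ?thesis
          by (simp add: g_def linear_cmul[OF has_derivative_linear[OF df[OF inS[OF that]]]])
      qed
      have "((\<lambda>s. f (z + s *\<^sub>R v + t *\<^sub>R w) - f (z + s *\<^sub>R v)) has_derivative
               (\<lambda>s'. s' * (g (z + s *\<^sub>R v + t *\<^sub>R w) - g (z + s *\<^sub>R v)))) (at s)"
        if "0 \<le> s" "s \<le> t" for s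
        using has_derivative_diff[OF fv[of s t] fv[of s 0]] that t by (simp add: algebra_simps)
      then obtain \<xi> where \<xi>: "\<xi> \<in> {0<..<t}"
        "f (z + t *\<^sub>R v + t *\<^sub>R w) - f (z + t *\<^sub>R v) - (f (z + 0 *\<^sub>R v + t *\<^sub>R w) - f (z + 0 *\<^sub>R v))
          = (t - 0) * (g (z + \<xi> *\<^sub>R v + t *\<^sub>R w) - g (z + \<xi> *\<^sub>R v))"
        using mvt_simple[of 0 t "\<lambda>s. f (z + s *\<^sub>R v + t *\<^sub>R w) - f (z + s *\<^sub>R v)"
            "\<lambda>s s'. s' * (g (z + s *\<^sub>R v + t *\<^sub>R w) - g (z + s *\<^sub>R v))"] t
          has_derivative_at_withinI by blast
      have "((\<lambda>s. g (z + \<xi> *\<^sub>R v + s *\<^sub>R w)) has_derivative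
                  (\<lambda>s'. s' * h (z + \<xi> *\<^sub>R v + s *\<^sub>R w))) (at s)"
        if "0 \<le> s" "s \<le> t" for s
      proof -
        have S: "z + \<xi> *\<^sub>R v + s *\<^sub>R w \<in> S"
          using \<xi> that by (intro inS) auto
        have "((\<lambda>s. g (z + \<xi> *\<^sub>R v + s *\<^sub>R w)) has_derivative
                (\<lambda>s'. frechet_derivative g (at (z + \<xi> *\<^sub>R v + s *\<^sub>R w)) (s' *\<^sub>R w))) (at s)"
          by (rule has_derivative_compose[where f = "\<lambda>s. z + \<xi> *\<^sub>R v + s *\<^sub>R w", OF _ dg[OF S]]) (auto intro!: derivative_eq_intros)
        then show ?thesis
          by (simp add: h_def linear_cmul[OF has_derivative_linear[OF dg[OF S]]])
      qed
      then obtain \<eta> where \<eta>: "\<eta> \<in> {0<..<t}"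
        "g (z + \<xi> *\<^sub>R v + t *\<^sub>R w) - g (z + \<xi> *\<^sub>R v + 0 *\<^sub>R w)
          = (t - 0) * h (z + \<xi> *\<^sub>R v + \<eta> *\<^sub>R w)"
        using mvt_simple[of 0 t "\<lambda>s. g (z + \<xi> *\<^sub>R v + s *\<^sub>R w)"
            "\<lambda>s s'. s' * h (z + \<xi> *\<^sub>R v + s *\<^sub>R w)"] t
          has_derivative_at_withinI by blast
      have "(f (z + t *\<^sub>R v + t *\<^sub>R w) - f (z + t *\<^sub>R v) - f (z + t *\<^sub>R w) + f z) / t\<^sup>2
          = h (z + \<xi> *\<^sub>R v + \<eta> *\<^sub>R w)"
        using \<xi>(2) \<eta>(2) t by (simp add: field_simps power2_eq_square)
      then show ?thesis
        using d(2) near[of \<xi> t \<eta>] \<xi> \<eta> t by simp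
    qed
    then have "\<forall>\<^sub>F t in at_right 0.
        dist ((f (z + t *\<^sub>R v + t *\<^sub>R w) - f (z + t *\<^sub>R v) - f (z + t *\<^sub>R w) + f z) / t\<^sup>2) (h z) < e"
      unfolding eventually_at_right_field using \<delta> by blast
    then show "\<forall>\<^sub>F t in at_right 0.
        dist ((f (z + t *\<^sub>R v + t *\<^sub>R w) - f (z + t *\<^sub>R v) - f (z + t *\<^sub>R w) + f z) / t\<^sup>2)
          (frechet_derivative (\<lambda>x. frechet_derivative f (at x) v) (at z) w) < e"
      unfolding h_def g_def .
  qed
qed

text \<open>The second difference is symmetric in \<open>v\<close> and \<open>w\<close>, so both
  iterated derivatives are limits of one and the same quotient.\<close>

lemma frechet_derivative_commute:
  fixes f :: "'a::real_normed_vector \<Rightarrow> real"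
  assumes "open S" "z \<in> S" "Ck_on 2 S f"
  shows "frechet_derivative (\<lambda>x. frechet_derivative f (at x) v) (at z) w =
         frechet_derivative (\<lambda>x. frechet_derivative f (at x) w) (at z) v"
proof (rule tendsto_unique[OF trivial_limit_at_right_real])
  show "((\<lambda>t. (f (z + t *\<^sub>R w + t *\<^sub>R v) - f (z + t *\<^sub>R w) - f (z + t *\<^sub>R v) + f z) / t\<^sup>2)
      \<longlongrightarrow> frechet_derivative (\<lambda>x. frechet_derivative f (at x) v) (at z) w) (at_right 0)"
    using second_difference_quotient_tendsto[OF assms, of v w] by (simp add: algebra_simps)
  show "((\<lambda>t. (f (z + t *\<^sub>R w + t *\<^sub>R v) - f (z + t *\<^sub>R w) - f (z + t *\<^sub>R v) + f z) / t\<^sup>2)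
      \<longlongrightarrow> frechet_derivative (\<lambda>x. frechet_derivative f (at x) w) (at z) v) (at_right 0)"
    by (rule second_difference_quotient_tendsto[OF assms])
qed

section \<open>Flatness of the logarithmic derivative of a frame\<close>

lemma frechet_derivativeD:
  "f differentiable (at x) \<Longrightarrow> (f has_derivative frechet_derivative f (at x)) (at x)"
  by (simp add: frechet_derivative_works)

text \<open>\<open>Ck_on\<close> speaks of derivatives in fixed directions, whereas here the
  direction \<open>Y x\<close> varies with the point. Expanding \<open>Y x\<close> in
  \<open>Basis\<close> reduces the claim to the product rule for finitely many fixed
  directions.\<close>

lemma has_derivative_directional_derivative:
  fixes f :: "'a::euclidean_space \<Rightarrow> real"
  assumes S: "open S" "z \<in> S" and f: "Ck_on 2 S f"
    and Y: "(Y has_derivative Y') (at z)"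
  shows "((\<lambda>x. frechet_derivative f (at x) (Y x)) has_derivative
    (\<lambda>h. frechet_derivative f (at z) (Y' h)
        + frechet_derivative (\<lambda>x. frechet_derivative f (at x) (Y z)) (at z) h)) (at z)"
proof -
  define D where "D b h = frechet_derivative (\<lambda>x. frechet_derivative f (at x) b) (at z) h" for b h
  have df: "linear (frechet_derivative f (at x))" if "x \<in> S" for x
    using f that by (intro linear_frechet_derivative) (auto simp: numeral_2_eq_2)
  have dD: "((\<lambda>x. frechet_derivative f (at x) b) has_derivative D b) (at z)" for b
    using f S unfolding D_def by (intro frechet_derivativeD) (auto simp: numeral_2_eq_2)
  have expand: "L u = (\<Sum>b\<in>Basis. (u \<bullet> b) * L b)" if "linear L" for L :: "'a \<Rightarrow> real" and u
    using linear_sum[OF that, of "\<lambda>b. (u \<bullet> b) *\<^sub>R b" Basis]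
    by (simp add: euclidean_representation linear_cmul[OF that])
  \<comment> \<open>\<open>D b h\<close> is linear in \<open>h\<close> because it is a derivative.
    Symmetry moves \<open>Y z\<close> into that slot for the expansion and moves the basis vectors
    back.\<close>
  have "D (Y z) h = D h (Y z)" for h
    unfolding D_def by (rule frechet_derivative_commute[OF S f])
  moreover have "D h (Y z) = (\<Sum>b\<in>Basis. (Y z \<bullet> b) * D h b)" for h
    by (rule expand[OF has_derivative_linear[OF dD]])
  moreover have "D h b = D b h" for h b
    unfolding D_def by (rule frechet_derivative_commute[OF S f])
  ultimately have DY: "D (Y z) h = (\<Sum>b\<in>Basis. (Y z \<bullet> b) * D b h)" for h
    by simp
  have "((\<lambda>x. \<Sum>b\<in>Basis. (Y x \<bullet> b) * frechet_derivative f (at x) b) has_derivative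
      (\<lambda>h. \<Sum>b\<in>Basis. (Y z \<bullet> b) * D b h + (Y' h \<bullet> b) * frechet_derivative f (at z) b)) (at z)"
    by (auto intro!: has_derivative_sum has_derivative_mult has_derivative_inner_left Y dD)
  then have "((\<lambda>x. \<Sum>b\<in>Basis. (Y x \<bullet> b) * frechet_derivative f (at x) b) has_derivative
      (\<lambda>h. frechet_derivative f (at z) (Y' h) + D (Y z) h)) (at z)"
    by (simp add: DY expand[OF df[OF S(2)], of "Y' _"] sum.distrib add.commute)
  then show ?thesis
    unfolding D_def[symmetric]
    by (rule has_derivative_transform_within_open[OF _ S]) (use expand[OF df] in metis)
qed

text \<open>The flatness equation \<open>d\<omega> + \<omega> \<and> \<omega> = 0\<close> for the logarithmic derivative \<open>\<omega>\<close> of a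
  frame, evaluated on two vector fields. Second derivatives are only taken of the frame, so that
  the coframe need not be known to be more than once differentiable.\<close>

lemma frame_maurer_cartan:
  fixes lam M :: "'i::finite \<Rightarrow> 'n::finite \<Rightarrow> 'a::euclidean_space \<Rightarrow> real"
    and X Y :: "'a \<Rightarrow> 'a"
  defines "\<omega> \<equiv> \<lambda>V \<alpha> \<nu> x. \<Sum>i\<in>UNIV. lam i \<alpha> x * frechet_derivative (M i \<nu>) (at x) (V x)"
  assumes S: "open S" "z \<in> S"
    and lam: "\<And>i \<alpha>. Ck_on 2 S (lam i \<alpha>)"
    and M: "\<And>i \<alpha> x. x \<in> S \<Longrightarrow> M i \<alpha> differentiable (at x)"
    and inv1: "\<And>\<alpha> \<beta> x. x \<in> S \<Longrightarrow> (\<Sum>i\<in>UNIV. lam i \<alpha> x * M i \<beta> x) = (if \<alpha> = \<beta> then 1 else 0)"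
    and inv2: "\<And>i j x. x \<in> S \<Longrightarrow> (\<Sum>\<alpha>\<in>UNIV. M i \<alpha> x * lam j \<alpha> x) = (if i = j then 1 else 0)"
    and X: "(X has_derivative X') (at z)" and Y: "(Y has_derivative Y') (at z)"
  shows "\<omega> X \<alpha> \<nu> differentiable (at z)"
    and "frechet_derivative (\<omega> Y \<alpha> \<nu>) (at z) (X z) - frechet_derivative (\<omega> X \<alpha> \<nu>) (at z) (Y z)
      + (\<Sum>\<epsilon>\<in>UNIV. \<omega> Y \<epsilon> \<nu> z * \<omega> X \<alpha> \<epsilon> z) - (\<Sum>\<epsilon>\<in>UNIV. \<omega> X \<epsilon> \<nu> z * \<omega> Y \<alpha> \<epsilon> z)
      = (\<Sum>i\<in>UNIV. lam i \<alpha> z * frechet_derivative (M i \<nu>) (at z) (Y' (X z) - X' (Y z)))"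
proof -
  have dlam: "(lam i \<alpha> has_derivative frechet_derivative (lam i \<alpha>) (at x)) (at x)" if "x \<in> S" for i \<alpha> x
    using lam that by (intro frechet_derivativeD) (auto simp: numeral_2_eq_2)
  note dM = frechet_derivativeD[OF M]
  \<comment> \<open>Derivative of the constant left side of \<open>inv1\<close>: it shifts the
    derivative from the coframe to the frame.\<close>
  have swap: "(\<Sum>i\<in>UNIV. lam i \<alpha> x * frechet_derivative (M i \<nu>) (at x) h)
      = - (\<Sum>i\<in>UNIV. M i \<nu> x * frechet_derivative (lam i \<alpha>) (at x) h)" if x: "x \<in> S" for \<alpha> \<nu> x h
  proof -
    have "((\<lambda>x. \<Sum>i\<in>UNIV. lam i \<alpha> x * M i \<nu> x) has_derivative
        (\<lambda>h. \<Sum>i\<in>UNIV. lam i \<alpha> x * frechet_derivative (M i \<nu>) (at x) h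
                       + frechet_derivative (lam i \<alpha>) (at x) h * M i \<nu> x)) (at x)"
      by (auto intro!: has_derivative_sum has_derivative_mult dlam dM x)
    moreover have "((\<lambda>x. \<Sum>i\<in>UNIV. lam i \<alpha> x * M i \<nu> x) has_derivative (\<lambda>h. 0)) (at x)"
      by (rule has_derivative_transform_within_open[OF has_derivative_const S(1) x]) (simp only: inv1)
    ultimately have "(\<lambda>h. \<Sum>i\<in>UNIV. lam i \<alpha> x * frechet_derivative (M i \<nu>) (at x) h
                       + frechet_derivative (lam i \<alpha>) (at x) h * M i \<nu> x) = (\<lambda>h. 0)"
      by (rule has_derivative_unique)
    from fun_cong[OF this, of h] show ?thesis
      by (simp add: sum.distrib mult.commute add_eq_0_iff2)
  qed
  have \<omega>_alt: "\<omega> V \<alpha> \<nu> x = - (\<Sum>i\<in>UNIV. M i \<nu> x * frechet_derivative (lam i \<alpha>) (at x) (V x))"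
    if "x \<in> S" for V \<alpha> \<nu> x
    unfolding \<omega>_def by (rule swap[OF that])
  have coframe: "frechet_derivative (M i \<nu>) (at z) (V z) = (\<Sum>\<epsilon>\<in>UNIV. M i \<epsilon> z * \<omega> V \<epsilon> \<nu> z)" for V i \<nu>
  proof -
    have "(\<Sum>\<epsilon>\<in>UNIV. M i \<epsilon> z * \<omega> V \<epsilon> \<nu> z) =
        (\<Sum>\<epsilon>\<in>UNIV. \<Sum>j\<in>UNIV. M i \<epsilon> z * lam j \<epsilon> z * frechet_derivative (M j \<nu>) (at z) (V z))"
      unfolding \<omega>_def by (simp add: sum_distrib_left mult.assoc)
    also have "\<dots> = (\<Sum>j\<in>UNIV. (\<Sum>\<epsilon>\<in>UNIV. M i \<epsilon> z * lam j \<epsilon> z) * frechet_derivative (M j \<nu>) (at z) (V z))"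
      by (subst sum.swap) (simp add: sum_distrib_right)
    also have "\<dots> = frechet_derivative (M i \<nu>) (at z) (V z)"
      by (simp add: inv2[OF S(2)] if_distrib[of "\<lambda>a. a * _"] cong: if_cong)
    finally show ?thesis ..
  qed
  \<comment> \<open>Products of a first derivative of the coframe with one of the frame are the
    source of the quadratic terms in \<omega>.\<close>
  have quad: "(\<Sum>i\<in>UNIV. frechet_derivative (M i \<nu>) (at z) (V z) * frechet_derivative (lam i \<alpha>) (at z) (W z))
      = - (\<Sum>\<epsilon>\<in>UNIV. \<omega> V \<epsilon> \<nu> z * \<omega> W \<alpha> \<epsilon> z)" for V W \<alpha> \<nu>
  proof -
    have "(\<Sum>i\<in>UNIV. frechet_derivative (M i \<nu>) (at z) (V z) * frechet_derivative (lam i \<alpha>) (at z) (W z)) =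
        (\<Sum>i\<in>UNIV. \<Sum>\<epsilon>\<in>UNIV. \<omega> V \<epsilon> \<nu> z * (M i \<epsilon> z * frechet_derivative (lam i \<alpha>) (at z) (W z)))"
      by (simp add: coframe sum_distrib_left sum_distrib_right mult_ac)
    also have "\<dots> = (\<Sum>\<epsilon>\<in>UNIV. \<omega> V \<epsilon> \<nu> z * (- \<omega> W \<alpha> \<epsilon> z))"
      by (subst sum.swap) (simp add: \<omega>_alt[OF S(2)] sum_distrib_left)
    finally show ?thesis
      by (simp add: sum_negf)
  qed
  have d\<omega>: "(\<omega> V \<alpha> \<nu> has_derivative
      (\<lambda>h. - (\<Sum>i\<in>UNIV. M i \<nu> z * (frechet_derivative (lam i \<alpha>) (at z) (V' h)
              + frechet_derivative (\<lambda>x. frechet_derivative (lam i \<alpha>) (at x) (V z)) (at z) h)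
            + frechet_derivative (M i \<nu>) (at z) h * frechet_derivative (lam i \<alpha>) (at z) (V z)))) (at z)"
    if V: "(V has_derivative V') (at z)" for V V'
  proof -
    have "((\<lambda>x. - (\<Sum>i\<in>UNIV. M i \<nu> x * frechet_derivative (lam i \<alpha>) (at x) (V x))) has_derivative
      (\<lambda>h. - (\<Sum>i\<in>UNIV. M i \<nu> z * (frechet_derivative (lam i \<alpha>) (at z) (V' h)
              + frechet_derivative (\<lambda>x. frechet_derivative (lam i \<alpha>) (at x) (V z)) (at z) h)
            + frechet_derivative (M i \<nu>) (at z) h * frechet_derivative (lam i \<alpha>) (at z) (V z)))) (at z)"
      by (intro has_derivative_minus has_derivative_sum has_derivative_mult dM S
          has_derivative_directional_derivative[OF S lam V])
    then show ?thesis
      by (rule has_derivative_transform_within_open[OF _ S]) (simp only: \<omega>_alt)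
  qed
  show "\<omega> X \<alpha> \<nu> differentiable (at z)"
    using d\<omega>[OF X] differentiableI by blast
  have deriv\<omega>: "frechet_derivative (\<omega> V \<alpha> \<nu>) (at z) (W z) =
      - (\<Sum>i\<in>UNIV. M i \<nu> z * frechet_derivative (lam i \<alpha>) (at z) (V' (W z)))
      - (\<Sum>i\<in>UNIV. M i \<nu> z * frechet_derivative (\<lambda>x. frechet_derivative (lam i \<alpha>) (at x) (V z)) (at z) (W z))
      + (\<Sum>\<epsilon>\<in>UNIV. \<omega> W \<epsilon> \<nu> z * \<omega> V \<alpha> \<epsilon> z)"
    if V: "(V has_derivative V') (at z)" for V V' W
    by (simp add: frechet_derivative_at[OF d\<omega>[OF V], symmetric] quad sum.distrib distrib_left)
  \<comment> \<open>\<open>Y' (X z) - X' (Y z)\<close> is the Lie bracket of \<open>X\<close> and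
    \<open>Y\<close> at \<open>z\<close>. In the antisymmetrised derivative of \<omega> the second
    derivatives of the frame cancel by symmetry and the quadratic terms cancel by
    \<open>quad\<close>; only this bracket term survives.\<close>
  have "(\<Sum>i\<in>UNIV. lam i \<alpha> z * frechet_derivative (M i \<nu>) (at z) (Y' (X z) - X' (Y z)))
      = - (\<Sum>i\<in>UNIV. M i \<nu> z * frechet_derivative (lam i \<alpha>) (at z) (Y' (X z)))
        + (\<Sum>i\<in>UNIV. M i \<nu> z * frechet_derivative (lam i \<alpha>) (at z) (X' (Y z)))"
    unfolding swap[OF S(2)]
    by (simp add: linear_diff[OF has_derivative_linear[OF dlam[OF S(2)]]] right_diff_distrib sum_subtractf)
  then show "frechet_derivative (\<omega> Y \<alpha> \<nu>) (at z) (X z) - frechet_derivative (\<omega> X \<alpha> \<nu>) (at z) (Y z)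
      + (\<Sum>\<epsilon>\<in>UNIV. \<omega> Y \<epsilon> \<nu> z * \<omega> X \<alpha> \<epsilon> z) - (\<Sum>\<epsilon>\<in>UNIV. \<omega> X \<epsilon> \<nu> z * \<omega> Y \<alpha> \<epsilon> z)
      = (\<Sum>i\<in>UNIV. lam i \<alpha> z * frechet_derivative (M i \<nu>) (at z) (Y' (X z) - X' (Y z)))"
    by (simp add: deriv\<omega>[OF X] deriv\<omega>[OF Y] frechet_derivative_commute[OF S lam, of _ _ "X z" "Y z"])
qed

section \<open>Differentiability of the inverse matrix\<close>

lemma differentiable_det:
  fixes B :: "'a::real_normed_vector \<Rightarrow> real^'n^'n"
  assumes "\<And>i j. (\<lambda>x. B x $ i $ j) differentiable (at z)"
  shows "(\<lambda>x. det (B x)) differentiable (at z)"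
proof -
  have "(\<lambda>x. \<Prod>i\<in>UNIV. B x $ i $ p i) differentiable (at z)" for p
    using has_derivative_prod[of UNIV "\<lambda>i x. B x $ i $ p i", OF frechet_derivativeD[OF assms]]
      differentiableI by blast
  then show ?thesis
    unfolding det_def by (auto intro!: differentiable_sum differentiable_mult)
qed

lemma matrix_inv_invertible:
  fixes A :: "'a::semiring_1^'n^'m"
  assumes "invertible A"
  shows "A ** matrix_inv A = mat 1" "matrix_inv A ** A = mat 1"
  using someI_ex[OF assms[unfolded invertible_def]] unfolding matrix_inv_def by auto

text \<open>By Cramer's rule each entry of the inverse is, on the open set \<open>S\<close>, a
  quotient of determinants with non-vanishing denominator. It serves for the coframe, which is
  defined through \<open>matrix_inv\<close>.\<close>

lemma differentiable_matrix_inv: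
  fixes B :: "'a::real_normed_vector \<Rightarrow> real^'n^'n"
  assumes S: "open S" "z \<in> S"
    and B: "\<And>i j. (\<lambda>x. B x $ i $ j) differentiable (at z)"
    and inv: "\<And>x. x \<in> S \<Longrightarrow> invertible (B x)"
  shows "(\<lambda>x. matrix_inv (B x) $ i $ j) differentiable (at z)"
proof -
  let ?C = "\<lambda>x. \<chi> k l. if l = i then axis j 1 $ k else B x $ k $ l"
  have cramer: "matrix_inv (B x) $ i $ j = det (?C x) / det (B x)" if "x \<in> S" for x
  proof -
    have "B x *v (matrix_inv (B x) *v axis j 1) = axis j 1"
      using inv[OF that] by (simp add: matrix_vector_mul_assoc matrix_inv_invertible)
    then have "matrix_inv (B x) *v axis j 1 =
        (\<chi> k. det (\<chi> m l. if l = k then axis j 1 $ m else B x $ m $ l) / det (B x))"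
      \<comment> \<open>\<open>cramer\<close> denotes the library theorem here; the local fact of
        that name is still being proved.\<close>
      using cramer inv[OF that] invertible_det_nz by blast
    then have "(matrix_inv (B x) *v axis j 1) $ i = det (?C x) / det (B x)"
      by simp
    then show ?thesis
      by (simp add: matrix_vector_mult_basis column_def)
  qed
  have "(\<lambda>x. ?C x $ k $ l) differentiable (at z)" for k l
    using B by (cases "l = i") auto
  then have "(\<lambda>x. det (?C x)) differentiable (at z)"
    by (rule differentiable_det)
  then have "(\<lambda>x. det (?C x) / det (B x)) differentiable (at z)"
    using inv S by (auto intro!: differentiable_divide differentiable_det B simp: invertible_det_nz)
  then show ?thesis
    unfolding differentiable_def
    using has_derivative_transform_within_open[OF _ S] cramer by (metis (no_types, lifting))
qed

section \<open>Coordinate changes and tangent vectors\<close>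

lemma smooth_manifold_charts:
  assumes "smooth_manifold X A" "c \<in> A"
  shows "inj_on (snd c) (fst c)" "openin X (fst c)" "open (snd c ` fst c)"
    and "openin X U \<Longrightarrow> U \<subseteq> fst c \<Longrightarrow> open (snd c ` U)"
proof -
  have c: "openin X (fst c)" "open (snd c ` fst c)"
    "homeomorphic_map (subtopology X (fst c)) (top_of_set (snd c ` fst c)) (snd c)"
    using assms unfolding smooth_manifold_def is_chart_def by auto
  show "openin X (fst c)" "open (snd c ` fst c)"
    by fact+
  have top: "topspace (subtopology X (fst c)) = fst c"
    using openin_subset[OF c(1)] by auto
  show "inj_on (snd c) (fst c)"
    using homeomorphic_imp_injective_map[OF c(3)] unfolding top .
  assume U: "openin X U" "U \<subseteq> fst c"
  then have "openin (subtopology X (fst c)) U"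
    using c(1) by (simp add: openin_open_subtopology)
  then have "openin (top_of_set (snd c ` fst c)) (snd c ` U)"
    using homeomorphic_map_openness[OF c(3), unfolded top, OF U(2)] by simp
  then show "open (snd c ` U)"
    using c(2) by (simp add: openin_open_eq)
qed

lemma chart_inv_chart:
  "smooth_manifold X A \<Longrightarrow> c \<in> A \<Longrightarrow> p \<in> fst c \<Longrightarrow> chart_inv c (snd c p) = p"
  unfolding chart_inv_def by (simp add: inv_into_f_f smooth_manifold_charts)

text \<open>Smoothness provides a total derivative; evaluated on the vectors
  \<open>axis \<alpha> 1\<close> it yields the partial derivatives that define \<open>jac\<close>.
  The chain rule for \<open>jac\<close> rests on this form.\<close>

lemma coord_change_has_derivative:
  assumes man: "smooth_manifold X A" and A: "c \<in> A" "d \<in> A" and p: "p \<in> fst c" "p \<in> fst d"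
  shows "(coord_change c d has_derivative (\<lambda>h. \<chi> \<beta>. \<Sum>\<alpha>\<in>UNIV. jac c d \<beta> \<alpha> (snd c p) * h $ \<alpha>)) (at (snd c p))"
proof -
  let ?F = "frechet_derivative (coord_change c d) (at (snd c p))"
  have "Ck_on (Suc 0) (overlap c d) (coord_change c d)"
    using man A unfolding smooth_manifold_def smooth_on_def by blast
  then have F: "(coord_change c d has_derivative ?F) (at (snd c p))"
    using p by (intro frechet_derivativeD) (auto simp: overlap_def)
  have "((\<lambda>x. coord_change c d x $ \<beta>) has_derivative (\<lambda>h. ?F h $ \<beta>)) (at (snd c p))" for \<beta>
    by (rule bounded_linear.has_derivative[OF bounded_linear_vec_nth F])
  then have jac: "jac c d \<beta> \<alpha> (snd c p) = ?F (axis \<alpha> 1) $ \<beta>" for \<beta> \<alpha>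
    unfolding jac_def pd_def by (metis frechet_derivative_at)
  have "?F h $ \<beta> = (\<Sum>\<alpha>\<in>UNIV. jac c d \<beta> \<alpha> (snd c p) * h $ \<alpha>)" for h \<beta>
  proof -
    have "?F h = ?F (\<Sum>\<alpha>\<in>UNIV. h $ \<alpha> *s axis \<alpha> 1)"
      by (simp only: basis_expansion)
    also have "\<dots> = (\<Sum>\<alpha>\<in>UNIV. h $ \<alpha> *\<^sub>R ?F (axis \<alpha> 1))"
      by (simp add: linear_sum[OF has_derivative_linear[OF F]] scalar_mult_eq_scaleR
          linear_cmul[OF has_derivative_linear[OF F]])
    finally show ?thesis
      by (simp add: jac mult.commute)
  qed
  then have "?F = (\<lambda>h. \<chi> \<beta>. \<Sum>\<alpha>\<in>UNIV. jac c d \<beta> \<alpha> (snd c p) * h $ \<alpha>)"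
    by (simp add: fun_eq_iff vec_eq_iff)
  with F show ?thesis
    by simp
qed

lemma jac_self:
  assumes man: "smooth_manifold X A" and c: "c \<in> A" and p: "p \<in> fst c"
  shows "(\<Sum>\<alpha>\<in>UNIV. jac c c \<beta> \<alpha> (snd c p) * h $ \<alpha>) = h $ \<beta>"
proof -
  have "(coord_change c c has_derivative (\<lambda>h. h)) (at (snd c p))"
    by (rule has_derivative_transform_within_open[OF has_derivative_ident smooth_manifold_charts(3)[OF man c]])
      (use p in \<open>auto simp: coord_change_def chart_inv_chart[OF man c]\<close>)
  from has_derivative_unique[OF coord_change_has_derivative[OF man c c p p] this]
  show ?thesis
    by (simp add: fun_eq_iff vec_eq_iff)
qed

text \<open>Chain rule: \<open>coord_change c e\<close> agrees with the composite through
  \<open>d\<close> on the chart image of \<open>fst c \<inter> fst d\<close>, an open neighbourhood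
  of \<open>snd c p\<close>.\<close>

lemma jac_cocycle:
  assumes man: "smooth_manifold X A" and A: "c \<in> A" "d \<in> A" "e \<in> A"
    and p: "p \<in> fst c" "p \<in> fst d" "p \<in> fst e"
  shows "(\<Sum>\<alpha>\<in>UNIV. jac c e \<gamma> \<alpha> (snd c p) * h $ \<alpha>) =
    (\<Sum>\<beta>\<in>UNIV. jac d e \<gamma> \<beta> (snd d p) * (\<Sum>\<alpha>\<in>UNIV. jac c d \<beta> \<alpha> (snd c p) * h $ \<alpha>))"
proof -
  have cd: "coord_change c d (snd c q) = snd d q" if "q \<in> fst c" for d q
    by (simp add: coord_change_def chart_inv_chart[OF man A(1) that])
  have de: "coord_change d e (snd d q) = snd e q" if "q \<in> fst d" for q
    by (simp add: coord_change_def chart_inv_chart[OF man A(2) that])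
  have "open (snd c ` (fst c \<inter> fst d))"
    using smooth_manifold_charts(2)[OF man A(1)] smooth_manifold_charts(2)[OF man A(2)]
    by (intro smooth_manifold_charts(4)[OF man A(1)] openin_Int) auto
  moreover have "(coord_change d e has_derivative
      (\<lambda>h. \<chi> \<gamma>. \<Sum>\<beta>\<in>UNIV. jac d e \<gamma> \<beta> (snd d p) * h $ \<beta>)) (at (coord_change c d (snd c p)))"
    using coord_change_has_derivative[OF man A(2,3) p(2,3)] by (simp add: cd p)
  note has_derivative_compose[OF coord_change_has_derivative[OF man A(1,2) p(1,2)] this]
  ultimately have "(coord_change c e has_derivative
      (\<lambda>h. \<chi> \<gamma>. \<Sum>\<beta>\<in>UNIV. jac d e \<gamma> \<beta> (snd d p) *
            (\<chi> \<beta>. \<Sum>\<alpha>\<in>UNIV. jac c d \<beta> \<alpha> (snd c p) * h $ \<alpha>) $ \<beta>)) (at (snd c p))"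
    using p by (elim has_derivative_transform_within_open) (auto simp: cd de)
  from has_derivative_unique[OF coord_change_has_derivative[OF man A(1,3) p(1,3)] this]
  show ?thesis
    by (simp add: fun_eq_iff vec_eq_iff)
qed

text \<open>Components prescribed in \<open>c\<close> are carried to the other charts by
  \<open>jac\<close>, and the cocycle rule makes the family a tangent vector. Hence
  \<open>induced_inv\<close>, being an \<open>inv_into\<close>, takes values in
  \<open>induced_dom\<close>.\<close>

lemma induced_chart_surj:
  assumes man: "smooth_manifold X A" and c: "c \<in> A" and z: "z \<in> induced_range c"
  shows "z \<in> induced_chart c ` induced_dom A c"
proof -
  obtain p where p: "p \<in> fst c" "fst z = snd c p"
    using z unfolding induced_range_def by auto
  define v where "v d = (if d \<in> A \<and> p \<in> fst d
    then \<chi> \<beta>. \<Sum>\<alpha>\<in>UNIV. jac c d \<beta> \<alpha> (snd c p) * snd z $ \<alpha> else 0)" for d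
  have "v \<in> tangent_space A p"
    unfolding tangent_space_def
  proof (intro CollectI conjI ballI impI allI)
    fix d e \<gamma> assume "d \<in> A" "e \<in> A" "p \<in> fst d \<inter> fst e"
    then show "v e $ \<gamma> = (\<Sum>\<beta>\<in>UNIV. jac d e \<gamma> \<beta> (snd d p) * v d $ \<beta>)"
      using jac_cocycle[OF man c _ _ p(1), of d e \<gamma> "snd z"] by (simp add: v_def)
  qed (auto simp: v_def)
  moreover have "v c = snd z"
    using jac_self[OF man c p(1)] c p(1) by (simp add: v_def vec_eq_iff)
  ultimately show ?thesis
    using p by (intro image_eqI[of _ _ "(p, v)"]) (auto simp: induced_chart_def induced_dom_def prod_eq_iff)
qed

text \<open>Independence is assumed for tangent vectors, that is, for components in all charts at
  once. The transformation law spreads a linear relation between the components in \<open>c\<close>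
  to every chart around the point, and elsewhere all components are 0; so the matrix has trivial
  kernel.\<close>

lemma invertible_section_comp:
  assumes gap: "gap_space X A lam" and c: "c \<in> A" and z: "z \<in> induced_range c"
  shows "invertible (\<chi> \<beta> j. section_comp A (lam j) c \<beta> z)"
proof -
  have man: "smooth_manifold X A"
    using gap by (simp add: gap_space_def)
  define u where "u = induced_inv A c z"
  have "u \<in> induced_dom A c"
    unfolding u_def induced_inv_def by (rule inv_into_into[OF induced_chart_surj[OF man c z]])
  then have p: "fst u \<in> fst c" and "u \<in> tangent_bundle X A"
    using openin_subset[OF smooth_manifold_charts(2)[OF man c]]
    by (auto simp: induced_dom_def tangent_bundle_def)
  then have tan: "\<And>i. lam i u \<in> tangent_space A (fst u)"
    and indep: "\<And>a. (\<forall>d. (\<Sum>i\<in>UNIV. a i *\<^sub>R lam i u d) = 0) \<Longrightarrow> \<forall>i. a i = 0"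
    using gap by (auto simp: gap_space_def pullback_section_def)
  have "a = 0" if a: "(\<chi> \<beta> j. section_comp A (lam j) c \<beta> z) *v a = 0" for a
  proof -
    have ac: "(\<Sum>i\<in>UNIV. a $ i * lam i u c $ \<alpha>) = 0" for \<alpha>
      using a by (simp add: vec_eq_iff matrix_vector_mult_def section_comp_def u_def mult.commute)
    have "(\<Sum>i\<in>UNIV. a $ i *\<^sub>R lam i u d) = 0" for d
    proof (cases "d \<in> A \<and> fst u \<in> fst d")
      case True
      then have trans: "lam i u d $ \<beta> = (\<Sum>\<alpha>\<in>UNIV. jac c d \<beta> \<alpha> (snd c (fst u)) * lam i u c $ \<alpha>)" for i \<beta>
        using tan[of i] c p by (auto simp: tangent_space_def)
      have "(\<Sum>i\<in>UNIV. a $ i *\<^sub>R lam i u d) $ \<beta> = 0" for \<beta>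
      proof -
        have "(\<Sum>i\<in>UNIV. a $ i *\<^sub>R lam i u d) $ \<beta> =
            (\<Sum>i\<in>UNIV. \<Sum>\<alpha>\<in>UNIV. jac c d \<beta> \<alpha> (snd c (fst u)) * (a $ i * lam i u c $ \<alpha>))"
          by (simp add: trans sum_distrib_left mult_ac)
        also have "\<dots> = (\<Sum>\<alpha>\<in>UNIV. jac c d \<beta> \<alpha> (snd c (fst u)) * (\<Sum>i\<in>UNIV. a $ i * lam i u c $ \<alpha>))"
          by (subst sum.swap) (simp add: sum_distrib_left)
        finally show ?thesis
          by (simp add: ac)
      qed
      then show ?thesis
        by (simp add: vec_eq_iff)
    next
      case False
      then have "lam i u d = 0" for i
        using tan[of i] unfolding tangent_space_def by blast
      then show ?thesis
        by simp
    qed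
    with indep[of "($) a"] show "a = 0"
      by (simp add: vec_eq_iff)
  qed
  then show ?thesis
    by (simp add: invertible_left_inverse matrix_left_invertible_ker)
qed

section \<open>Horizontal and vertical vector fields\<close>

text \<open>The operator \<open>delta N \<mu>\<close> as a vector-valued map, the form in which
  \<open>frame_maurer_cartan\<close> takes its fields.\<close>

definition hfield :: "'n::finite coef2 \<Rightarrow> 'n \<Rightarrow> (real^'n) \<times> (real^'n) \<Rightarrow> (real^'n) \<times> (real^'n)" where
  "hfield N \<mu> z = (axis \<mu> 1, - (\<chi> \<alpha>. N \<alpha> \<mu> z))"

definition vfield :: "'n::finite \<Rightarrow> (real^'n) \<times> (real^'n) \<Rightarrow> (real^'n) \<times> (real^'n)" where
  "vfield \<mu> z = (0, axis \<mu> 1)"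

lemma frechet_derivative_vertical:
  assumes "f differentiable (at z)"
  shows "frechet_derivative f (at z) (0, y) = (\<Sum>\<alpha>\<in>UNIV. y $ \<alpha> * py \<alpha> f z)"
proof -
  note lin = linear_frechet_derivative[OF assms]
  have "linear (Pair (0::real^'n) :: real^'n \<Rightarrow> _)"
    by (auto intro!: linearI)
  from linear_compose[OF this lin]
  have L: "linear (\<lambda>y. frechet_derivative f (at z) (0, y))"
    by (simp add: o_def)
  have "frechet_derivative f (at z) (0, y) = frechet_derivative f (at z) (0, \<Sum>\<alpha>\<in>UNIV. y $ \<alpha> *s axis \<alpha> 1)"
    by (simp only: basis_expansion)
  also have "\<dots> = (\<Sum>\<alpha>\<in>UNIV. y $ \<alpha> * py \<alpha> f z)"
    unfolding py_def linear_sum[OF L] scalar_mult_eq_scaleR linear_cmul[OF L] by simp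
  finally show ?thesis .
qed

text \<open>Linearity of the derivative merges the terms of \<open>delta\<close>. Differentiability
  is assumed because \<open>frechet_derivative\<close> is an arbitrary choice at other
  points.\<close>

lemma delta_eq:
  assumes "f differentiable (at z)"
  shows "delta N \<mu> f z = frechet_derivative f (at z) (hfield N \<mu> z)"
proof -
  have "frechet_derivative f (at z) (hfield N \<mu> z) =
      frechet_derivative f (at z) ((axis \<mu> 1, 0) + (0, - (\<chi> \<alpha>. N \<alpha> \<mu> z)))"
    by (simp add: hfield_def)
  also have "\<dots> = px \<mu> f z + frechet_derivative f (at z) (0, - (\<chi> \<alpha>. N \<alpha> \<mu> z))"
    unfolding px_def by (rule linear_add[OF linear_frechet_derivative[OF assms]])
  finally show ?thesis
    by (simp add: frechet_derivative_vertical[OF assms] delta_def sum_negf)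
qed

lemma py_eq: "py \<mu> f z = frechet_derivative f (at z) (vfield \<mu> z)"
  by (simp add: py_def vfield_def)

text \<open>The first component of the field is constant, so its derivative is vertical; so are,
  therefore, all brackets of horizontal and vertical fields.\<close>

lemma hfield_has_derivative:
  assumes "\<And>\<alpha>. N \<alpha> \<mu> differentiable (at z)"
  shows "(hfield N \<mu> has_derivative (\<lambda>h. (0, - (\<chi> \<alpha>. frechet_derivative (N \<alpha> \<mu>) (at z) h)))) (at z)"
proof -
  have "((\<lambda>z. \<chi> \<alpha>. N \<alpha> \<mu> z) has_derivative (\<lambda>h. \<chi> \<alpha>. frechet_derivative (N \<alpha> \<mu>) (at z) h)) (at z)"
    by (subst has_derivative_componentwise_within)
      (auto simp: Basis_vec_def inner_axis intro!: frechet_derivativeD assms)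
  then show ?thesis
    unfolding hfield_def[abs_def] by (intro has_derivative_Pair has_derivative_const has_derivative_minus)
qed

lemma vfield_has_derivative: "(vfield \<mu> has_derivative (\<lambda>h. 0)) (at z)"
  unfolding vfield_def[abs_def] by simp

theorem corollary4p3:
  fixes X :: "'m topology"
    and A :: "('m, 'n::finite) chart set"
    and lam :: "'n \<Rightarrow> ('m, 'n) psection"
    and N :: "('m, 'n) chart \<Rightarrow> 'n coef2"
  assumes gap: "gap_space X A lam"
    and nlc: "nonlinear_connection A N"
  shows "\<forall>c\<in>A. \<forall>z\<in>induced_range c. \<forall>\<alpha> \<nu> \<mu> \<sigma>.
           h_curvature (canonical_d_connection A lam N c) \<alpha> \<nu> \<mu> \<sigma> z = 0 \<and>
           v_curvature (canonical_d_connection A lam N c) \<alpha> \<nu> \<mu> \<sigma> z = 0 \<and>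
           hv_curvature (canonical_d_connection A lam N c) \<alpha> \<nu> \<mu> \<sigma> z = 0"
proof (intro ballI allI)
  fix c z \<alpha> \<nu> \<mu> \<sigma>
  assume c: "c \<in> A" and z: "z \<in> induced_range c"
  define S where "S = induced_range c"
  define l where "l i = section_comp A (lam i) c" for i
  define M where "M = colam A lam c"
  define D where "D = canonical_d_connection A lam N c"
  define \<omega> where "\<omega> V \<alpha> \<nu> x = (\<Sum>i\<in>UNIV. l i \<alpha> x * frechet_derivative (M i \<nu>) (at x) (V x))" for V \<alpha> \<nu> x
  have man: "smooth_manifold X A"
    using gap by (simp add: gap_space_def)
  have S: "open S" "z \<in> S"
    using z smooth_manifold_charts(3)[OF man c] by (simp_all add: S_def induced_range_def open_Times)
  have l: "Ck_on 2 S (l i \<alpha>)" for i \<alpha>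
    using gap c unfolding gap_space_def pullback_section_def smooth_on_def S_def l_def by blast
  then have dl: "l i \<alpha> differentiable (at x)" if "x \<in> S" for i \<alpha> x
    using that by (auto simp: numeral_2_eq_2)
  have "Ck_on (Suc 0) S (N c \<alpha> \<beta>)" for \<alpha> \<beta>
    using nlc c unfolding nonlinear_connection_def smooth_on_def S_def by blast
  then have dN: "N c \<alpha> \<beta> differentiable (at z)" for \<alpha> \<beta>
    using S by simp
  have inv: "invertible (\<chi> \<beta> j. l j \<beta> x)" if "x \<in> S" for x
    using invertible_section_comp[OF gap c] that by (simp add: S_def l_def)
  have M: "M i \<alpha> x = matrix_inv (\<chi> \<beta> j. l j \<beta> x) $ i $ \<alpha>" for i \<alpha> x
    by (simp add: M_def colam_def l_def)
  have dM: "M i \<alpha> differentiable (at x)" if "x \<in> S" for i \<alpha> x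
    unfolding M[abs_def]
    by (rule differentiable_matrix_inv[OF S(1) that _ inv]) (simp_all add: dl that)
  have inv1: "(\<Sum>i\<in>UNIV. l i \<alpha> x * M i \<beta> x) = (if \<alpha> = \<beta> then 1 else 0)" if "x \<in> S" for \<alpha> \<beta> x
    using arg_cong[OF matrix_inv_invertible(1)[OF inv[OF that]], of "\<lambda>B. B $ \<alpha> $ \<beta>"]
    by (simp add: matrix_matrix_mult_def mat_def M)
  have inv2: "(\<Sum>\<alpha>\<in>UNIV. M i \<alpha> x * l j \<alpha> x) = (if i = j then 1 else 0)" if "x \<in> S" for i j x
    using arg_cong[OF matrix_inv_invertible(2)[OF inv[OF that]], of "\<lambda>B. B $ i $ j"]
    by (simp add: matrix_matrix_mult_def mat_def M)
  have mc: "\<omega> X \<alpha> \<nu> differentiable (at z)"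
    "frechet_derivative (\<omega> Y \<alpha> \<nu>) (at z) (X z) - frechet_derivative (\<omega> X \<alpha> \<nu>) (at z) (Y z)
      + (\<Sum>\<epsilon>\<in>UNIV. \<omega> Y \<epsilon> \<nu> z * \<omega> X \<alpha> \<epsilon> z) - (\<Sum>\<epsilon>\<in>UNIV. \<omega> X \<epsilon> \<nu> z * \<omega> Y \<alpha> \<epsilon> z)
      = (\<Sum>i\<in>UNIV. l i \<alpha> z * frechet_derivative (M i \<nu>) (at z) (Y' (X z) - X' (Y z)))"
    if "(X has_derivative X') (at z)" "(Y has_derivative Y') (at z)" for X Y X' Y' \<alpha> \<nu>
    by (rule frame_maurer_cartan[where lam = l and M = M, OF S l dM inv1 inv2 that, folded \<omega>_def]; assumption)+
  note dh = hfield_has_derivative[where N = "N c", OF dN]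
  note dv = vfield_has_derivative
  have nl: "nl D = N c"
    by (simp add: D_def canonical_d_connection_def)
  \<comment> \<open>This holds on \<open>S\<close>, where the coframe is known to be differentiable;
    derivatives of \<open>hor\<close> are then transferred by openness of \<open>S\<close>.\<close>
  have hor: "hor D \<alpha> \<nu> \<mu> x = \<omega> (hfield (N c) \<mu>) \<alpha> \<nu> x" if "x \<in> S" for \<alpha> \<nu> \<mu> x
    using delta_eq[OF dM[OF that]]
    by (simp add: D_def canonical_d_connection_def \<omega>_def l_def M_def)
  have ver: "ver D \<alpha> \<nu> \<mu> = \<omega> (vfield \<mu>) \<alpha> \<nu>" for \<alpha> \<nu> \<mu>
    by (simp add: D_def canonical_d_connection_def \<omega>_def l_def M_def py_eq fun_eq_iff)
  have dhor: "(hor D \<alpha> \<nu> \<mu> has_derivative frechet_derivative (\<omega> (hfield (N c) \<mu>) \<alpha> \<nu>) (at z)) (at z)" for \<alpha> \<nu> \<mu>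
    by (rule has_derivative_transform_within_open[OF frechet_derivativeD[OF mc(1)[OF dh dh]] S])
      (simp add: hor)
  have dver: "ver D \<alpha> \<nu> \<mu> differentiable (at z)" for \<alpha> \<nu> \<mu>
    unfolding ver by (rule mc(1)[OF dv dv])
  have delta_hor: "delta (N c) \<sigma> (hor D \<alpha> \<nu> \<mu>) z =
      frechet_derivative (\<omega> (hfield (N c) \<mu>) \<alpha> \<nu>) (at z) (hfield (N c) \<sigma> z)" for \<alpha> \<nu> \<mu> \<sigma>
    using delta_eq[OF differentiableI[OF dhor]] by (simp add: frechet_derivative_at[OF dhor, symmetric])
  have py_hor: "py \<sigma> (hor D \<alpha> \<nu> \<mu>) z =
      frechet_derivative (\<omega> (hfield (N c) \<mu>) \<alpha> \<nu>) (at z) (vfield \<sigma> z)" for \<alpha> \<nu> \<mu> \<sigma>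
    by (simp add: py_eq frechet_derivative_at[OF dhor, symmetric])
  \<comment> \<open>Evaluates the bracket term of \<open>mc\<close> for a vertical bracket
    \<open>(0, y)\<close>: a contraction of \<open>y\<close> with \<open>ver D\<close>.\<close>
  have vertical: "(\<Sum>i\<in>UNIV. l i \<alpha> z * frechet_derivative (M i \<nu>) (at z) (0, y)) =
      (\<Sum>\<epsilon>\<in>UNIV. y $ \<epsilon> * ver D \<alpha> \<nu> \<epsilon> z)" for y
  proof -
    have "(\<Sum>i\<in>UNIV. l i \<alpha> z * frechet_derivative (M i \<nu>) (at z) (0, y)) =
        (\<Sum>i\<in>UNIV. \<Sum>\<epsilon>\<in>UNIV. y $ \<epsilon> * (l i \<alpha> z * py \<epsilon> (M i \<nu>) z))"
      by (simp add: frechet_derivative_vertical[OF dM[OF S(2)]] sum_distrib_left mult_ac)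
    also have "\<dots> = (\<Sum>\<epsilon>\<in>UNIV. y $ \<epsilon> * ver D \<alpha> \<nu> \<epsilon> z)"
      by (subst sum.swap) (simp add: ver \<omega>_def py_eq sum_distrib_left)
    finally show ?thesis .
  qed
  \<comment> \<open>The bracket of the fields with indices \<sigma> and \<mu> has vertical
    components \<open>- nl_curv D \<epsilon> \<mu> \<sigma> z\<close>, so the bracket term is minus
    \<open>L_tensor\<close>.\<close>
  have "h_curvature D \<alpha> \<nu> \<mu> \<sigma> z = 0"
    using mc(2)[OF dh[of \<sigma>] dh[of \<mu>], of \<alpha> \<nu>]
    by (simp add: h_curvature_def L_tensor_def nl_curv_def nl delta_hor hor[OF S(2)] vertical
        delta_eq[OF dN] algebra_simps sum_subtractf)
  \<comment> \<open>Constant fields have bracket 0, and \<open>vertical[of 0]\<close> evaluates the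
    bracket term to 0.\<close>
  moreover have "v_curvature D \<alpha> \<nu> \<mu> \<sigma> z = 0"
    using mc(2)[OF dv[of \<sigma>] dv[of \<mu>], of \<alpha> \<nu>] vertical[of 0]
    by (simp add: v_curvature_def ver py_eq zero_prod_def)
  \<comment> \<open>The bracket has vertical components
    \<open>py \<mu> (N c \<epsilon> \<sigma>) z\<close>, matching the first part of
    \<open>P_torsion\<close>. The second part cancels the last sum of
    \<open>h_cov12\<close>.\<close>
  moreover have "hv_curvature D \<alpha> \<nu> \<mu> \<sigma> z = 0"
    using mc(2)[OF dh[of \<sigma>] dv[of \<mu>], of \<alpha> \<nu>]
    by (simp add: hv_curvature_def h_cov12_def P_torsion_def nl py_hor hor[OF S(2)] delta_eq[OF dver, unfolded ver]
        vertical py_eq[of _ "N c _ _"] ver algebra_simps sum_subtractf)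
  ultimately show "h_curvature (canonical_d_connection A lam N c) \<alpha> \<nu> \<mu> \<sigma> z = 0 \<and>
      v_curvature (canonical_d_connection A lam N c) \<alpha> \<nu> \<mu> \<sigma> z = 0 \<and>
      hv_curvature (canonical_d_connection A lam N c) \<alpha> \<nu> \<mu> \<sigma> z = 0"
    by (simp add: D_def)
qed

end
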